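(* There are absolute constants $c_1,c_2>0$ such that for all $n\ge2$ and $\varepsilon\in(0,1]$, if $m\le c_1 2^{n/2}/\varepsilon$ then the minimax risk of estimating a degree-$1$ Bayes net on $\{0,1\}^n$ in $\chi^2$ divergence from $m$ samples satisfies $$R_{\chi^2}(m)=\inf_{Q}\ \sup_{P}\ \mathbb E_{\vec s\sim P^{\otimes m}}\left[d_{\chi^2}(P,Q_{\vec s})\right]\ \ge\ c_2\,\varepsilon ,$$ where the supremum is over degree-$1$ Bayes nets $P$ on $\{0,1\}^n$. In particular, for a suitable choice of the parameter $\varepsilon_0=\varepsilon_0(n,\varepsilon)\in(0,1)$, the same lower bound holds when the supremum is restricted to the family $\mathcal P_{\varepsilon_0}=\{P^{(y)}: y\in\{0,1\}^{n-1}\}$ of degree-$1$ Bayes nets defined in the context, so learning this family to $\chi^2$ divergence $\varepsilon$ requires $\Omega(2^{n/2}/\varepsilon)$ samples.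
   Context: A degree-$1$ Bayes net on $\{0,1\}^n$ is a distribution $P$ such that, for some directed acyclic graph on $[n]$ with all in-degrees at most $1$ and parent sets $\Pi_i$, $P(x)=\prod_{i=1}^n P(x_i\mid x_{\Pi_i})$. $d_{\chi^2}(P,Q)=\sum_x\frac{(P(x)-Q(x))^2}{Q(x)}$, with a term equal to $0$ if $P(x)=Q(x)=0$ and $+\infty$ if $P(x)>0=Q(x)$. The infimum is over all deterministic algorithms $Q$ taking $m$ samples, i.e. maps $\vec s=(s_1,\dots,s_m)\mapsto Q_{\vec s}$ from $(\{0,1\}^n)^m$ to probability distributions on $\{0,1\}^n$. Family $\mathcal P_{\varepsilon_0}$: for $y\in\{0,1\}^{n-1}$, $P^{(y)}$ is the distribution of $(X_1,\dots,X_n)$ with $\Pr[X_1=1]=\varepsilon_0$; conditioned on $X_1=1$, $(X_2,\dots,X_n)=y$ with probability $1$; conditioned on $X_1=0$, $(X_2,\dots,X_n)$ is uniform on $\{0,1\}^{n-1}$. *)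

theory Defs
  imports "HOL-Probability.Probability"
begin

text \<open>
  Points of \<open>{0,1}\<^sup>I\<close> are extensional Boolean functions on the coordinate set \<open>I\<close> (\<open>True\<close> is 1).
  The ambient cube \<open>{0,1}\<^sup>n\<close> is \<open>cube {1..n}\<close>.
\<close>
definition cube :: "nat set \<Rightarrow> (nat \<Rightarrow> bool) set" where
  "cube I = I \<rightarrow>\<^sub>E UNIV"

definition dists :: "nat \<Rightarrow> (nat \<Rightarrow> bool) pmf set" where
  "dists n = {P. set_pmf P \<subseteq> cube {1..n}}"

text \<open>
  An edge \<open>(j, i) \<in> E\<close> points from the parent \<open>j\<close> to the child \<open>i\<close>. In the library,
  conditioning on a null event gives 0. This is harmless here: if the parents of some node take
  values of probability 0 at \<open>x\<close>, then \<open>P x = 0\<close>, and the product vanishes too.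
\<close>
definition degree1_bayes_nets :: "nat \<Rightarrow> (nat \<Rightarrow> bool) pmf set" where
  "degree1_bayes_nets n = {P \<in> dists n. \<exists>E \<subseteq> {1..n} \<times> {1..n}.
     acyclic E \<and>
     (\<forall>i\<in>{1..n}. card {j. (j, i) \<in> E} \<le> 1) \<and>
     (\<forall>x\<in>cube {1..n}. pmf P x =
        (\<Prod>i\<in>{1..n}. \<P>(z in measure_pmf P. z i = x i \<bar> \<forall>j. (j, i) \<in> E \<longrightarrow> z j = x j)))}"

definition chi2_div :: "nat \<Rightarrow> (nat \<Rightarrow> bool) pmf \<Rightarrow> (nat \<Rightarrow> bool) pmf \<Rightarrow> ennreal" where
  "chi2_div n P Q = (\<Sum>x\<in>cube {1..n}.
     if pmf Q x = 0 then (if pmf P x = 0 then 0 else \<infinity>)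
     else ennreal ((pmf P x - pmf Q x)\<^sup>2 / pmf Q x))"

text \<open>
  Algorithms are only constrained on actual sample sequences, i.e. lists of length \<open>m\<close> over the cube.
\<close>
definition algorithms ::
  "nat \<Rightarrow> nat \<Rightarrow> ((nat \<Rightarrow> bool) list \<Rightarrow> (nat \<Rightarrow> bool) pmf) set" where
  "algorithms n m =
     {Q. \<forall>s. length s = m \<and> set s \<subseteq> cube {1..n} \<longrightarrow> Q s \<in> dists n}"

definition risk ::
  "nat \<Rightarrow> nat \<Rightarrow> ((nat \<Rightarrow> bool) list \<Rightarrow> (nat \<Rightarrow> bool) pmf) \<Rightarrow> (nat \<Rightarrow> bool) pmf \<Rightarrow> ennreal" where
  "risk n m Q P = (\<integral>\<^sup>+ s. chi2_div n P (Q s) \<partial>measure_pmf (replicate_pmf m P))"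

definition minimax_risk :: "nat \<Rightarrow> nat \<Rightarrow> (nat \<Rightarrow> bool) pmf set \<Rightarrow> ennreal" where
  "minimax_risk n m \<P> = (INF Q\<in>algorithms n m. SUP P\<in>\<P>. risk n m Q P)"

text \<open>
  The parameter \<open>y \<in> {0,1}\<^sup>n\<^sup>-\<^sup>1\<close> is indexed by the coordinates \<open>2, \<dots>, n\<close> that it prescribes.
\<close>
definition hard_dist :: "nat \<Rightarrow> real \<Rightarrow> (nat \<Rightarrow> bool) \<Rightarrow> (nat \<Rightarrow> bool) pmf" where
  "hard_dist n \<epsilon>\<^sub>0 y = do {
     b \<leftarrow> bernoulli_pmf \<epsilon>\<^sub>0;
     z \<leftarrow> (if b then return_pmf y else pmf_of_set (cube {2..n}));
     return_pmf (z(1 := b))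
   }"

definition hard_family :: "nat \<Rightarrow> real \<Rightarrow> (nat \<Rightarrow> bool) pmf set" where
  "hard_family n \<epsilon>\<^sub>0 = hard_dist n \<epsilon>\<^sub>0 ` cube {2..n}"

end

theory Submission
  imports Defs
begin

text \<open>
  Write \<open>N = 2\<^sup>n\<^sup>-\<^sup>1\<close>. With probability at least \<open>1 - m \<epsilon>\<^sub>0\<close> no sample has first coordinate 1, and then the
  samples carry no information on \<open>y\<close>. If the estimate puts mass \<open>q\<close> on \<open>(1, z)\<close>, the contributions of
  this point to the divergences, summed over all \<open>y\<close>, are
  \<open>(\<epsilon>\<^sub>0 - q)\<^sup>2 / q + (N - 1) q = \<epsilon>\<^sub>0\<^sup>2 / q + N q - 2 \<epsilon>\<^sub>0\<close>, which by AM-GM is at least \<open>2 \<epsilon>\<^sub>0 (\<surd>N - 1)\<close>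
  whatever \<open>q\<close> is. Averaging over \<open>y\<close> bounds the risk below by \<open>(1 - m \<epsilon>\<^sub>0) 2 \<epsilon>\<^sub>0 (\<surd>N - 1)\<close>, and
  \<open>\<epsilon>\<^sub>0 = 4 \<epsilon> / \<surd>N\<close>, capped at \<open>1/2\<close>, gives the claim.
\<close>

section \<open>Cubes and their splitting at coordinate 1\<close>

lemma finite_cube: "finite I \<Longrightarrow> finite (cube I)"
  by (simp add: cube_def finite_PiE)

lemma cube_nonempty: "cube I \<noteq> {}"
  by (simp add: cube_def PiE_eq_empty_iff)

lemma card_cube: "finite I \<Longrightarrow> card (cube I) = 2 ^ card I"
  by (simp add: cube_def card_PiE)

lemma card_cube_coordinate:
  assumes "finite I" "i \<in> I"
  shows "card (cube I \<inter> {z. z i = b}) = 2 ^ (card I - 1)"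
proof -
  have "cube I \<inter> {z. z i = b} = (\<Pi>\<^sub>E j\<in>I. if j = i then {b} else UNIV)"
    using assms(2) by (auto simp: cube_def PiE_iff split: if_splits)
  moreover have "(\<Prod>j\<in>I. card (if j = i then {b} else UNIV)) = (\<Prod>j\<in>I. if j = i then 1 else 2)"
    by (rule prod.cong) auto
  ultimately show ?thesis
    using assms by (simp add: card_PiE prod.remove[of I i])
qed

lemma cube_fun_upd: "y \<in> cube {2..n} \<Longrightarrow> 1 \<le> n \<Longrightarrow> y(1 := b) \<in> cube {1..n}"
  by (auto simp: cube_def PiE_iff extensional_def)

lemma cube_decompose:
  assumes "x \<in> cube {1..n}" "1 \<le> n"
  obtains z where "z \<in> cube {2..n}" "x = z(1 := x 1)"
proof
  show "x(1 := undefined) \<in> cube {2..n}"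
    using assms by (auto simp: cube_def PiE_iff extensional_def)
qed simp

text \<open>Extensionality makes \<open>y\<close> and \<open>z\<close> both \<open>undefined\<close>
  at 1, so overwriting that coordinate loses no information.\<close>

lemma cube_fun_upd_inject:
  assumes "y \<in> cube {2..n}" "z \<in> cube {2..n}"
  shows "y(1 := b) = z(1 := b') \<longleftrightarrow> y = z \<and> b = b'"
proof -
  have "y 1 = z 1"
    using assms by (simp add: cube_def PiE_def extensional_def)
  then show ?thesis
    by (auto simp: fun_eq_iff split: if_splits)
qed

section \<open>The hard distributions as two-component mixtures\<close>

text \<open>For \<open>e < 1\<close> this is the law of \<open>hard_dist n e y\<close> conditioned
  on first coordinate 0, hence the same for all \<open>y\<close>.\<close>

definition no_spike :: "nat \<Rightarrow> (nat \<Rightarrow> bool) pmf" where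
  "no_spike n = map_pmf (\<lambda>z. z(1 := False)) (pmf_of_set (cube {2..n}))"

lemma measure_no_spike:
  "measure (measure_pmf (no_spike n)) A =
     card (cube {2..n} \<inter> {z. z(1 := False) \<in> A}) / 2 ^ (n - 1)"
  by (simp add: no_spike_def measure_pmf_of_set finite_cube cube_nonempty card_cube vimage_def)

text \<open>Only the spike term involves \<open>y\<close>. The integral form yields probabilities
  via indicators and, by dropping the spike term, the comparison with
  \<open>no_spike\<close>.\<close>

lemma nn_integral_hard_dist:
  assumes "0 \<le> e" "e \<le> 1"
  shows "(\<integral>\<^sup>+ x. f x \<partial>measure_pmf (hard_dist n e y)) =
    ennreal e * f (y(1 := True)) + ennreal (1 - e) * (\<integral>\<^sup>+ x. f x \<partial>measure_pmf (no_spike n))"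
  using assms by (simp add: hard_dist_def no_spike_def mult.commute)

lemma measure_hard_dist:
  assumes "0 \<le> e" "e \<le> 1"
  shows "measure (measure_pmf (hard_dist n e y)) A =
    e * indicator A (y(1 := True)) + (1 - e) * measure (measure_pmf (no_spike n)) A"
proof -
  have "ennreal (measure (measure_pmf (hard_dist n e y)) A) = emeasure (measure_pmf (hard_dist n e y)) A"
    by (simp add: measure_pmf.emeasure_eq_measure)
  also have "\<dots> = (\<integral>\<^sup>+ x. indicator A x \<partial>measure_pmf (hard_dist n e y))"
    by simp
  also have "\<dots> = ennreal e * indicator A (y(1 := True)) +
      ennreal (1 - e) * emeasure (measure_pmf (no_spike n)) A"
    by (subst nn_integral_hard_dist[OF assms]) simp
  also have "\<dots> = ennreal (e * indicator A (y(1 := True)) + (1 - e) * measure (measure_pmf (no_spike n)) A)"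
    using assms by (simp add: measure_pmf.emeasure_eq_measure ennreal_mult ennreal_plus ennreal_indicator)
  finally show ?thesis
    using assms by (subst (asm) ennreal_inj) auto
qed

lemma pmf_hard_dist_True:
  assumes "0 \<le> e" "e \<le> 1" "y \<in> cube {2..n}" "z \<in> cube {2..n}"
  shows "pmf (hard_dist n e y) (z(1 := True)) = (if z = y then e else 0)"
proof -
  have "cube {2..n} \<inter> {w. w(1 := False) \<in> {z(1 := True)}} = {}"
    by (auto dest: fun_cong[of _ _ 1])
  then show ?thesis
    using assms by (auto simp: measure_pmf_single[symmetric] measure_hard_dist measure_no_spike
        cube_fun_upd_inject simp del: One_nat_def)
qed

lemma pmf_hard_dist_False:
  assumes "0 \<le> e" "e \<le> 1" "z \<in> cube {2..n}"
  shows "pmf (hard_dist n e y) (z(1 := False)) = (1 - e) / 2 ^ (n - 1)"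
proof -
  have "cube {2..n} \<inter> {w. w(1 := False) \<in> {z(1 := False)}} = {z}"
    using assms(3) by (auto simp: cube_fun_upd_inject simp del: One_nat_def)
  moreover have "y(1 := True) \<noteq> z(1 := False)"
    by (metis fun_upd_same)
  ultimately show ?thesis
    using assms by (simp add: measure_pmf_single[symmetric] measure_hard_dist measure_no_spike)
qed

lemma measure_hard_dist_root:
  assumes "0 \<le> e" "e \<le> 1"
  shows "measure (measure_pmf (hard_dist n e y)) {z. z 1 = a} = (if a then e else 1 - e)"
  using assms
  by (cases a) (simp_all add: measure_hard_dist measure_no_spike card_cube)

lemma measure_hard_dist_child:
  assumes "0 \<le> e" "e \<le> 1" "i \<in> {2..n}"
  shows "measure (measure_pmf (hard_dist n e y)) {z. z i = b \<and> z 1 = a} =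
    (if a then (if y i = b then e else 0) else (1 - e) / 2)"
proof -
  \<comment> \<open>Fixing bit \<open>i\<close> leaves \<open>2 ^ (n - 2)\<close> of the
    \<open>2 ^ (n - 1)\<close> points; the shift in the exponent is what produces the factor
    1/2.\<close>
  have "i \<noteq> 1" and n: "n - 1 = Suc (n - 2)" using assms(3) by auto
  then have "cube {2..n} \<inter> {z. z(1 := False) \<in> {z. z i = b \<and> z 1 = a}} =
      (if a then {} else cube {2..n} \<inter> {z. z i = b})"
    by auto
  moreover have "card (cube {2..n} \<inter> {z. z i = b}) = 2 ^ (n - 2)"
    using card_cube_coordinate[of "{2..n}" i b] assms(3) by (simp add: numeral_2_eq_2)
  ultimately show ?thesis
    using assms(1,2) \<open>i \<noteq> 1\<close> n by (auto simp: measure_hard_dist measure_no_spike)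
qed

section \<open>The Bayes net structure of the hard family\<close>

text \<open>The graph is a star with root 1: given the root, the other bits are independent, either
  constants \<open>y i\<close> or fair coins. As \<open>0 < e < 1\<close>, neither value of the root
  is a null event.\<close>

lemma hard_dist_degree1:
  assumes e: "0 < e" "e < 1" and n: "2 \<le> n" and y: "y \<in> cube {2..n}"
  shows "hard_dist n e y \<in> degree1_bayes_nets n"
proof -
  let ?P = "hard_dist n e y"
  define E :: "(nat \<times> nat) set" where "E = {1} \<times> {2..n}"
  have dist: "?P \<in> dists n"
    using assms by (auto simp: dists_def hard_dist_def finite_cube cube_nonempty cube_fun_upd
        simp del: One_nat_def split: if_splits)
  have sub: "E \<subseteq> {1..n} \<times> {1..n}"
    using n by (auto simp: E_def)
  have "E \<subseteq> less_than"
    by (auto simp: E_def)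
  then have acyc: "acyclic E"
    by (meson wf_acyclic wf_less_than wf_subset)
  have par: "{j. (j, i) \<in> E} = (if i \<in> {2..n} then {1} else {})" for i
    by (auto simp: E_def)
  then have card: "\<forall>i\<in>{1..n}. card {j. (j, i) \<in> E} \<le> 1"
    by simp
  have root: "\<P>(z in measure_pmf ?P. z 1 = x 1 \<bar> \<forall>j. (j, 1) \<in> E \<longrightarrow> z j = x j) =
      (if x 1 then e else 1 - e)" for x
  proof -
    have "(j, 1) \<notin> E" for j by (simp add: E_def)
    then show ?thesis
      using measure_hard_dist_root[of e n y "x 1"] e
      by (simp add: cond_prob_def del: One_nat_def)
  qed
  have child: "\<P>(z in measure_pmf ?P. z i = x i \<bar> \<forall>j. (j, i) \<in> E \<longrightarrow> z j = x j) =
      (if x 1 then (if y i = x i then 1 else 0) else 1 / 2)" if "i \<in> {2..n}" for i x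
  proof -
    have "(j, i) \<in> E \<longleftrightarrow> j = 1" for j using that by (simp add: E_def)
    then show ?thesis
      using measure_hard_dist_root[of e n y "x 1"] measure_hard_dist_child[of e i n y "x i" "x 1"] e that
      by (simp add: cond_prob_def del: One_nat_def)
  qed
  have "pmf ?P x = (\<Prod>i\<in>{1..n}. \<P>(z in measure_pmf ?P. z i = x i \<bar> \<forall>j. (j, i) \<in> E \<longrightarrow> z j = x j))"
    if x: "x \<in> cube {1..n}" for x
  proof -
    obtain z where z: "z \<in> cube {2..n}" "x = z(1 := x 1)"
      using cube_decompose[OF x] n by auto
    have I: "{1..n} = insert 1 {2..n}" using n by auto
    have zx: "x i = z i" if "i \<in> {2..n}" for i
      using that by (subst z(2)) simp
    have "(\<Prod>i\<in>{1..n}. \<P>(z in measure_pmf ?P. z i = x i \<bar> \<forall>j. (j, i) \<in> E \<longrightarrow> z j = x j)) =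
      (if x 1 then e else 1 - e) * (\<Prod>i\<in>{2..n}. if x 1 then (if y i = x i then 1 else 0) else 1 / 2)"
      unfolding I by (subst prod.insert) (use root child in \<open>auto simp del: One_nat_def\<close>)
    also have "\<dots> = pmf ?P x"
    proof (cases "x 1")
      case True
      \<comment> \<open>Agreement on \<open>{2..n}\<close> determines points of the cube, so the
        product of the 0/1 factors is the indicator of \<open>z = y\<close>.\<close>
      have "z = y \<longleftrightarrow> (\<forall>i\<in>{2..n}. y i = x i)"
        using z(1) y zx PiE_ext[of z "{2..n}" _ y] by (auto simp: cube_def)
      moreover have "(\<Prod>i\<in>{2..n}. if y i = x i then 1 else 0 :: real) =
          (if \<forall>i\<in>{2..n}. y i = x i then 1 else 0)"
        by (auto intro!: prod.neutral)
      moreover have "pmf ?P x = (if z = y then e else 0)"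
        using pmf_hard_dist_True[of e y n z] e y z True by simp
      ultimately show ?thesis using True by simp
    next
      case False
      moreover have "pmf ?P x = (1 - e) / 2 ^ (n - 1)"
        using pmf_hard_dist_False[of e z n y] e z False by simp
      ultimately show ?thesis by (simp add: power_one_over field_simps)
    qed
    finally show ?thesis by simp
  qed
  then show ?thesis
    unfolding degree1_bayes_nets_def using dist sub acyc card by blast
qed

section \<open>Comparison of sample laws\<close>

text \<open>Domination of one sample tensorizes, by peeling off the first sample. With
  \<open>c = 1 - e\<close> and \<open>R = no_spike n\<close> this replaces conditioning on the event
  that no sample shows the spike.\<close>

lemma nn_integral_replicate_pmf_mono:
  assumes "\<And>f :: 'a \<Rightarrow> ennreal. c * (\<integral>\<^sup>+ x. f x \<partial>measure_pmf R) \<le> (\<integral>\<^sup>+ x. f x \<partial>measure_pmf P)"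
  shows "c ^ m * (\<integral>\<^sup>+ s. f s \<partial>measure_pmf (replicate_pmf m R)) \<le>
    (\<integral>\<^sup>+ s. f s \<partial>measure_pmf (replicate_pmf m P))"
proof (induction m arbitrary: f)
  case 0
  then show ?case by simp
next
  case (Suc m)
  have "c ^ Suc m * (\<integral>\<^sup>+ s. f s \<partial>measure_pmf (replicate_pmf (Suc m) R)) =
      c * (\<integral>\<^sup>+ x. c ^ m * (\<integral>\<^sup>+ s. f (x # s) \<partial>measure_pmf (replicate_pmf m R)) \<partial>measure_pmf R)"
    by (simp add: nn_integral_cmult mult.assoc)
  also have "\<dots> \<le> c * (\<integral>\<^sup>+ x. (\<integral>\<^sup>+ s. f (x # s) \<partial>measure_pmf (replicate_pmf m P)) \<partial>measure_pmf R)"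
    by (intro mult_left_mono nn_integral_mono Suc.IH) simp
  also have "\<dots> \<le> (\<integral>\<^sup>+ x. (\<integral>\<^sup>+ s. f (x # s) \<partial>measure_pmf (replicate_pmf m P)) \<partial>measure_pmf P)"
    by (rule assms)
  finally show ?case by simp
qed

section \<open>Lower bound for the divergences summed over the family\<close>

definition chi2_term :: "real \<Rightarrow> real \<Rightarrow> ennreal" where
  "chi2_term p q = (if q = 0 then (if p = 0 then 0 else \<infinity>) else ennreal ((p - q)\<^sup>2 / q))"

lemma sum_chi2_term_ge:
  assumes C: "finite C" "z \<in> C" and e: "0 < e" and q: "0 \<le> q"
  shows "ennreal (2 * e * (sqrt (card C) - 1)) \<le> (\<Sum>y\<in>C. chi2_term (if z = y then e else 0) q)"
proof (cases "q = 0")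
  case True
  \<comment> \<open>An estimate without mass at this point already pays an infinite term at
    \<open>y = z\<close>.\<close>
  have "chi2_term e q \<le> (\<Sum>y\<in>C. chi2_term (if z = y then e else 0) q)"
    using member_le_sum[OF C(2), of "\<lambda>y. chi2_term (if z = y then e else 0) q"] C by simp
  moreover have "chi2_term e q = \<top>"
    using True e by (simp add: chi2_term_def)
  ultimately show ?thesis by (simp add: top_unique)
next
  case False
  then have q: "q > 0" using q by simp
  define N where "N = real (card C)"
  have N: "1 \<le> N" using C card_gt_0_iff[of C] by (auto simp: N_def)
  have "(\<Sum>y\<in>C. chi2_term (if z = y then e else 0) q) =
      ennreal (\<Sum>y\<in>C. ((if z = y then e else 0) - q)\<^sup>2 / q)"
    using q by (simp add: chi2_term_def sum_ennreal)
  also have "(\<Sum>y\<in>C. ((if z = y then e else 0) - q)\<^sup>2 / q) =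
      (e - q)\<^sup>2 / q + (\<Sum>y\<in>C - {z}. q)"
  proof -
    have "(\<Sum>y\<in>C - {z}. ((if z = y then e else 0) - q)\<^sup>2 / q) = (\<Sum>y\<in>C - {z}. q)"
      using q by (intro sum.cong) (auto simp: power2_eq_square)
    then show ?thesis
      using C by (simp add: sum.remove[of C z])
  qed
  also have "\<dots> = (e - q)\<^sup>2 / q + (N - 1) * q"
    using C N by (simp add: N_def of_nat_diff)
  \<comment> \<open>AM-GM in the form of a completed square; equality would need
    \<open>q = e / sqrt N\<close>.\<close>
  also have "\<dots> = 2 * e * (sqrt N - 1) + (e - sqrt N * q)\<^sup>2 / q"
    using q N by (simp add: field_simps power2_eq_square)
  finally show ?thesis
    using q by (auto simp: N_def intro!: ennreal_leI)
qed

text \<open>Only points with first coordinate 1 are kept. After swapping the sums, each such point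
  is handled separately with its own mass \<open>q\<close>, so the bound is uniform in
  \<open>Q\<close>.\<close>

lemma sum_chi2_div_ge:
  assumes e: "0 < e" "e \<le> 1" and n: "1 \<le> n"
  shows "ennreal (2 ^ (n - 1) * (2 * e * (sqrt (2 ^ (n - 1)) - 1))) \<le>
    (\<Sum>y\<in>cube {2..n}. chi2_div n (hard_dist n e y) Q)"
proof -
  let ?C = "cube {2..n}"
  have fin: "finite ?C" by (simp add: finite_cube)
  have "ennreal (2 ^ (n - 1) * (2 * e * (sqrt (2 ^ (n - 1)) - 1))) =
      (\<Sum>z\<in>?C. ennreal (2 * e * (sqrt (card ?C) - 1)))"
    using e by (simp add: card_cube ennreal_mult ennreal_of_nat_eq_real_of_nat
        del: real_sqrt_power)
  also have "\<dots> \<le> (\<Sum>z\<in>?C. \<Sum>y\<in>?C. chi2_term (if z = y then e else 0) (pmf Q (z(1 := True))))"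
    by (intro sum_mono sum_chi2_term_ge fin e) auto
  also have "\<dots> = (\<Sum>y\<in>?C. \<Sum>z\<in>?C. chi2_term (if z = y then e else 0) (pmf Q (z(1 := True))))"
    by (rule sum.swap)
  also have "\<dots> \<le> (\<Sum>y\<in>?C. chi2_div n (hard_dist n e y) Q)"
  proof (rule sum_mono)
    fix y assume y: "y \<in> ?C"
    let ?t = "\<lambda>x. chi2_term (pmf (hard_dist n e y) x) (pmf Q x)"
    have "(\<Sum>z\<in>?C. chi2_term (if z = y then e else 0) (pmf Q (z(1 := True)))) =
        (\<Sum>z\<in>?C. ?t (z(1 := True)))"
      using e y by (intro sum.cong refl) (simp add: pmf_hard_dist_True del: One_nat_def)
    also have "\<dots> = sum ?t ((\<lambda>z. z(1 := True)) ` ?C)"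
      by (subst sum.reindex) (auto simp: inj_on_def cube_fun_upd_inject simp del: One_nat_def)
    also have "\<dots> \<le> sum ?t (cube {1..n})"
      using n by (intro sum_mono2) (auto simp: finite_cube cube_fun_upd simp del: One_nat_def)
    also have "\<dots> = chi2_div n (hard_dist n e y) Q"
      by (simp add: chi2_div_def chi2_term_def)
    finally show "(\<Sum>z\<in>?C. chi2_term (if z = y then e else 0) (pmf Q (z(1 := True)))) \<le>
        chi2_div n (hard_dist n e y) Q" .
  qed
  finally show ?thesis .
qed

section \<open>From divergences to risk\<close>

text \<open>Averaging over \<open>y\<close> bounds any common upper bound \<open>B\<close> of the
  risks. Stating this for \<open>B\<close> serves both the minimax bound and the sample
  count.\<close>

lemma hard_family_risk_ge:
  assumes e: "0 < e" "e < 1" and n: "1 \<le> n"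
    and B: "\<And>P. P \<in> hard_family n e \<Longrightarrow> risk n m Q P \<le> B"
  shows "ennreal ((1 - real m * e) * (2 * e * (sqrt (2 ^ (n - 1)) - 1))) \<le> B"
proof -
  let ?C = "cube {2..n}" and ?N = "2 ^ (n - 1) :: real"
  let ?b = "2 * e * (sqrt ?N - 1)"
  have b: "0 \<le> ?b" using e by simp
  have "ennreal (?N * ((1 - real m * e) * ?b)) \<le> ennreal ((1 - e) ^ m * (?N * ?b))"
  proof (rule ennreal_leI)
    \<comment> \<open>Bernoulli's inequality also covers a negative left side, for which
      \<open>ennreal\<close> truncates the claimed bound to 0.\<close>
    have "1 - real m * e \<le> (1 - e) ^ m"
      using Bernoulli_inequality[of "- e" m] e by simp
    then have "(1 - real m * e) * (?N * ?b) \<le> (1 - e) ^ m * (?N * ?b)"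
      using b by (intro mult_right_mono) auto
    then show "?N * ((1 - real m * e) * ?b) \<le> (1 - e) ^ m * (?N * ?b)"
      by (simp only: mult_ac)
  qed
  also have "\<dots> = ennreal (1 - e) ^ m * (\<integral>\<^sup>+ s. ennreal (?N * ?b) \<partial>measure_pmf (replicate_pmf m (no_spike n)))"
    using e by (simp add: ennreal_mult' ennreal_power del: real_sqrt_power)
  also have "\<dots> \<le> ennreal (1 - e) ^ m * (\<integral>\<^sup>+ s. (\<Sum>y\<in>?C. chi2_div n (hard_dist n e y) (Q s))
      \<partial>measure_pmf (replicate_pmf m (no_spike n)))"
    using e n by (intro mult_left_mono nn_integral_mono sum_chi2_div_ge) auto
  also have "\<dots> = (\<Sum>y\<in>?C. ennreal (1 - e) ^ m * (\<integral>\<^sup>+ s. chi2_div n (hard_dist n e y) (Q s)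
      \<partial>measure_pmf (replicate_pmf m (no_spike n))))"
    by (simp add: nn_integral_sum sum_distrib_left)
  \<comment> \<open>Here the true sample law enters: its mixture dominates \<open>1 - e\<close>
    times \<open>no_spike n\<close>.\<close>
  also have "\<dots> \<le> (\<Sum>y\<in>?C. risk n m Q (hard_dist n e y))"
    unfolding risk_def
    by (intro sum_mono nn_integral_replicate_pmf_mono) (use e in \<open>simp add: nn_integral_hard_dist\<close>)
  also have "\<dots> \<le> (\<Sum>y\<in>?C. B)"
    by (intro sum_mono B) (simp add: hard_family_def)
  also have "\<dots> = ennreal ?N * B"
    by (simp add: card_cube ennreal_of_nat_eq_real_of_nat)
  finally have "ennreal ?N * ennreal ((1 - real m * e) * ?b) \<le> ennreal ?N * B"
    by (simp add: ennreal_mult' del: real_sqrt_power)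
  then show ?thesis
    by (subst (asm) ennreal_mult_le_mult_iff) auto
qed

lemma minimax_risk_mono:
  "\<P> \<subseteq> \<P>' \<Longrightarrow> minimax_risk n m \<P> \<le> minimax_risk n m \<P>'"
  unfolding minimax_risk_def by (intro INF_mono' SUP_subset_mono) auto

lemma minimax_risk_hard_family_ge:
  assumes "0 < e" "e < 1" "1 \<le> n"
  shows "ennreal ((1 - real m * e) * (2 * e * (sqrt (2 ^ (n - 1)) - 1))) \<le> minimax_risk n m (hard_family n e)"
  unfolding minimax_risk_def
  by (intro INF_greatest hard_family_risk_ge[OF assms]) (rule SUP_upper)

section \<open>Choice of constants\<close>

text \<open>The threshold \<open>K\<close> keeps the cap on \<open>\<epsilon>\<^sub>0\<close>
  inactive, so the lower bound strictly exceeds \<epsilon>, as the sample count claim needs.\<close>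

theorem proposition4p2:
  "\<exists>c\<^sub>1 c\<^sub>2 c\<^sub>3 K :: real. c\<^sub>1 > 0 \<and> c\<^sub>2 > 0 \<and> c\<^sub>3 > 0 \<and>
     (\<forall>n::nat. \<forall>\<epsilon>::real. n \<ge> 2 \<and> 0 < \<epsilon> \<and> \<epsilon> \<le> 1 \<longrightarrow>
        (\<forall>m::nat. real m \<le> c\<^sub>1 * 2 powr (real n / 2) / \<epsilon> \<longrightarrow>
           minimax_risk n m (degree1_bayes_nets n) \<ge> ennreal (c\<^sub>2 * \<epsilon>)) \<and>
        (\<exists>\<epsilon>\<^sub>0::real. 0 < \<epsilon>\<^sub>0 \<and> \<epsilon>\<^sub>0 < 1 \<and>
           hard_family n \<epsilon>\<^sub>0 \<subseteq> degree1_bayes_nets n \<and>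
           (\<forall>m::nat. real m \<le> c\<^sub>1 * 2 powr (real n / 2) / \<epsilon> \<longrightarrow>
              minimax_risk n m (hard_family n \<epsilon>\<^sub>0) \<ge> ennreal (c\<^sub>2 * \<epsilon>)) \<and>
           (2 powr (real n / 2) / \<epsilon> \<ge> K \<longrightarrow>
              (\<forall>m::nat. \<forall>Q\<in>algorithms n m.
                 (\<forall>P\<in>hard_family n \<epsilon>\<^sub>0. risk n m Q P \<le> ennreal \<epsilon>) \<longrightarrow>
                 real m \<ge> c\<^sub>3 * 2 powr (real n / 2) / \<epsilon>))))"
proof -
  have main: "\<exists>e. 0 < e \<and> e < 1 \<and>
      hard_family n e \<subseteq> degree1_bayes_nets n \<and>
      (\<forall>m::nat. real m \<le> 1/16 * 2 powr (real n / 2) / \<epsilon> \<longrightarrow>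
         minimax_risk n m (hard_family n e) \<ge> ennreal (1/10 * \<epsilon>)) \<and>
      (2 powr (real n / 2) / \<epsilon> \<ge> 16 \<longrightarrow>
         (\<forall>m::nat. \<forall>Q\<in>algorithms n m.
            (\<forall>P\<in>hard_family n e. risk n m Q P \<le> ennreal \<epsilon>) \<longrightarrow>
            real m \<ge> 1/16 * 2 powr (real n / 2) / \<epsilon>))"
    if n: "n \<ge> 2" and eps: "0 < \<epsilon>" "\<epsilon> \<le> 1" for n :: nat and \<epsilon> :: real
  proof -
    define r where "r = sqrt (2 ^ (n - 1))"
    define w where "w = 2 powr (real n / 2)"
    \<comment> \<open>The risk bound is roughly \<open>2 * e * r\<close>, so
      \<open>4 * \<epsilon> / r\<close> leaves a factor 8 for the losses below; the cap ensures
      \<open>e < 1\<close>.\<close>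
    define e where "e = min (4 * \<epsilon> / r) (1 / 2)"
    have "(2::real) ^ 1 \<le> 2 ^ (n - 1)" using n by (intro power_increasing) auto
    then have r2: "2 \<le> r\<^sup>2" by (simp add: r_def)
    have r0: "0 < r" by (simp add: r_def)
    \<comment> \<open>7/5 is a rational lower bound for \<open>sqrt 2\<close>, the value of
      \<open>r\<close> at \<open>n = 2\<close>; it gives \<open>r - 1 \<ge> 2 / 7 * r\<close>
      later.\<close>
    have r: "7 / 5 \<le> r" using r2 r0 by (intro power2_le_imp_le[of "7/5" r]) (auto simp: power2_eq_square)
    have w: "w = sqrt 2 * r"
    proof -
      have "w = sqrt (2 ^ n)"
        unfolding w_def by (simp add: powr_half_sqrt_powr powr_realpow)
      also have "2 ^ n = (2::real) * 2 ^ (n - 1)"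
        using n by (subst power_Suc[symmetric]) simp
      finally show ?thesis by (simp add: r_def real_sqrt_mult)
    qed
    have s2: "sqrt 2 < 3 / 2"
      by (rule real_less_lsqrt) (auto simp: power2_eq_square)
    then have wr: "w \<le> 3 / 2 * r" using w r0 by simp
    have e: "0 < e" "e < 1" using eps r0 by (auto simp: e_def)
    have me: "real m * e \<le> 1 / 2 - 1 / 8" if "real m \<le> 1/16 * w / \<epsilon>" for m
    proof -
      have "real m * e \<le> (1/16 * w / \<epsilon>) * (4 * \<epsilon> / r)"
        using that e eps r0 by (intro mult_mono) (auto simp: e_def w)
      also have "\<dots> = w / (4 * r)" using eps by (simp add: field_simps)
      also have "\<dots> \<le> 3 / 8" using wr r0 by (simp add: field_simps)
      finally show ?thesis by simp
    qed
    have lower: "1 / 10 * \<epsilon> \<le> (1 - real m * e) * (2 * e * (r - 1))" if "real m \<le> 1/16 * w / \<epsilon>" for m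
    proof -
      \<comment> \<open>Without the cap \<open>e * r = 4 * \<epsilon>\<close>; with it
        \<open>e * r = r / 2\<close>, and \<open>r \<ge> 1 \<ge> \<epsilon>\<close>.\<close>
      have "\<epsilon> / 2 \<le> e * r"
        using eps r r0 by (cases "4 * \<epsilon> / r \<le> 1 / 2") (auto simp: e_def min_def)
      moreover have "2 / 7 * r \<le> r - 1" using r by simp
      then have "e * (2 / 7 * r) \<le> e * (r - 1)" using e by (intro mult_left_mono) auto
      ultimately have "2 * \<epsilon> / 7 \<le> 2 * e * (r - 1)" by simp
      then have "(1 / 2) * (2 * \<epsilon> / 7) \<le> (1 - real m * e) * (2 * e * (r - 1))"
        using me[OF that] eps by (intro mult_mono) auto
      then show ?thesis using eps by simp
    qed
    have sharp: "\<epsilon> < (1 - real m * e) * (2 * e * (r - 1))" if "real m \<le> 1/16 * w / \<epsilon>" "16 \<le> w / \<epsilon>" for m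
    proof -
      \<comment> \<open>From \<open>16 * \<epsilon> \<le> w \<le> 3 / 2 * r\<close> follows
        \<open>4 * \<epsilon> / r \<le> 3 / 8\<close>, so the cap is inactive and the final bound is
        \<open>8 / 7 * \<epsilon>\<close>.\<close>
      have "16 * \<epsilon> \<le> w" using that(2) eps by (simp add: field_simps)
      then have "4 * \<epsilon> / r \<le> 1 / 2" using wr r0 by (simp add: field_simps)
      then have "e * r = 4 * \<epsilon>" using r0 by (simp add: e_def)
      moreover have "e * (2 / 7 * r) \<le> e * (r - 1)" using e r by (intro mult_left_mono) auto
      ultimately have "16 * \<epsilon> / 7 \<le> 2 * e * (r - 1)" by simp
      then have "(1 / 2) * (16 * \<epsilon> / 7) \<le> (1 - real m * e) * (2 * e * (r - 1))"
        using me[OF that(1)] eps by (intro mult_mono) auto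
      moreover have "\<epsilon> < (1 / 2) * (16 * \<epsilon> / 7)" using eps by simp
      ultimately show ?thesis by (rule order.strict_trans2[rotated])
    qed
    have "hard_family n e \<subseteq> degree1_bayes_nets n"
      using hard_dist_degree1[OF e n] by (auto simp: hard_family_def)
    moreover have "ennreal (1/10 * \<epsilon>) \<le> minimax_risk n m (hard_family n e)"
      if "real m \<le> 1/16 * w / \<epsilon>" for m
      using ennreal_leI[OF lower[OF that]] minimax_risk_hard_family_ge[of e n m] e n
      unfolding r_def by (meson le_trans one_le_numeral order_trans)
    moreover have "1/16 * w / \<epsilon> \<le> real m"
      if "16 \<le> w / \<epsilon>" "\<forall>P\<in>hard_family n e. risk n m Q P \<le> ennreal \<epsilon>" for m Q
    proof (rule ccontr)
      assume "\<not> 1/16 * w / \<epsilon> \<le> real m"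
      then have "\<epsilon> < (1 - real m * e) * (2 * e * (r - 1))" using sharp that by simp
      moreover have "ennreal ((1 - real m * e) * (2 * e * (r - 1))) \<le> ennreal \<epsilon>"
        using hard_family_risk_ge[of e n m Q "ennreal \<epsilon>"] e n that(2) by (simp add: r_def)
      ultimately show False using eps by (simp add: ennreal_le_iff)
    qed
    ultimately show ?thesis
      using e unfolding w_def[symmetric] by blast
  qed
  show ?thesis
  proof (rule exI[of _ "1/16"], rule exI[of _ "1/10"], rule exI[of _ "1/16"], rule exI[of _ "16"],
      intro conjI allI impI)
    fix n m :: nat and \<epsilon> :: real
    assume "n \<ge> 2 \<and> 0 < \<epsilon> \<and> \<epsilon> \<le> 1" and m: "real m \<le> 1/16 * 2 powr (real n / 2) / \<epsilon>"
    then obtain e where "hard_family n e \<subseteq> degree1_bayes_nets n"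
      "ennreal (1/10 * \<epsilon>) \<le> minimax_risk n m (hard_family n e)"
      using main[of n \<epsilon>] by blast
    then show "ennreal (1/10 * \<epsilon>) \<le> minimax_risk n m (degree1_bayes_nets n)"
      using minimax_risk_mono order_trans by blast
  qed (rule main | simp)+
qed

end
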